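(* Let $d,k\ge 1$ and $n\ge 2$. Then the group $\mathrm{RFA}(\mathbb{Z}^d,n,k)$ of reversible finite-state automata is not finitely generated.
   Context: Let $\Sigma=\{0,\dots,n-1\}$ (tape symbols), $Q=\{1,\dots,k\}$ (states). The shift on $\Sigma^{\mathbb{Z}^d}$ is $(\sigma^{v}(x))_{u}=x_{u-v}$. $\mathrm{RFA}(\mathbb{Z}^d,n,k)$ is the group, under composition, of all bijections $T$ of $\Sigma^{\mathbb{Z}^d}\times Q\times\mathbb{Z}^d$ (tape, state, head position) for which there are a finite set $F\subset\mathbb{Z}^d$ and a function $f:\Sigma^{F}\times Q\to Q\times\mathbb{Z}^d$ such that $T(x,q,v)=(x,q',v+u)$ where $(q',u)=f(\sigma^{-v}(x)|_{F},q)$, and whose inverse is also of this form. (These are the reversible Turing machines that never modify the tape.) *)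

theory Defs
  imports
    "HOL-Analysis.Finite_Cartesian_Product"
    "HOL-Algebra.Bij"
    "HOL-Algebra.Generated_Groups"
begin

type_synonym 'd tape = "int ^ 'd \<Rightarrow> nat"
type_synonym 'd config = "'d tape \<times> nat \<times> (int ^ 'd)"

definition shift :: "int ^ 'd \<Rightarrow> 'd tape \<Rightarrow> 'd tape"
  where "shift v x = (\<lambda>u. x (u - v))"

text \<open>Tape symbols are \<open>{0..<n}\<close> and states are \<open>{1..k}\<close>.\<close>

definition configs :: "nat \<Rightarrow> nat \<Rightarrow> 'd::finite config set"
  where "configs n k = (UNIV \<rightarrow> {0..<n}) \<times> {1..k} \<times> UNIV"

definition finite_state_rule :: "nat \<Rightarrow> nat \<Rightarrow> ('d::finite config \<Rightarrow> 'd config) \<Rightarrow> bool"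
  where "finite_state_rule n k T \<longleftrightarrow>
    (\<exists>(F :: (int ^ 'd) set) (f :: 'd tape \<times> nat \<Rightarrow> nat \<times> (int ^ 'd)).
       finite F \<and>
       f \<in> (F \<rightarrow>\<^sub>E {0..<n}) \<times> {1..k} \<rightarrow> {1..k} \<times> UNIV \<and>
       (\<forall>(x, q, v) \<in> configs n k.
          T (x, q, v) = (let (q', u) = f (restrict (shift (- v) x) F, q) in (x, q', v + u))))"

text \<open>The type argument carries the dimension \<open>d = CARD('d)\<close>.\<close>

definition RFA :: "'d::finite itself \<Rightarrow> nat \<Rightarrow> nat \<Rightarrow> ('d config \<Rightarrow> 'd config) monoid"
  where "RFA _ n k = BijGroup (configs n k)
    \<lparr>carrier := {T \<in> Bij (configs n k).
       finite_state_rule n k T \<and> finite_state_rule n k (inv_into (configs n k) T)}\<rparr>"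

definition finitely_generated :: "('a, 'b) monoid_scheme \<Rightarrow> bool"
  where "finitely_generated G \<longleftrightarrow>
    (\<exists>S. finite S \<and> S \<subseteq> carrier G \<and> generate G S = carrier G)"

lemma finite_state_rule_cong:
  assumes "\<And>c. c \<in> configs n k \<Longrightarrow> T c = T' c"
  shows "finite_state_rule n k T \<longleftrightarrow> finite_state_rule n k T'"
proof -
  have "T (x, q, v) = T' (x, q, v)" if "(x, q, v) \<in> configs n k" for x q v
    using assms that by blast
  then show ?thesis
    unfolding finite_state_rule_def by (simp add: Ball_def)
qed

lemma finite_state_rule_id: "finite_state_rule n k (\<lambda>c. c)"
  unfolding finite_state_rule_def
  by (rule exI[of _ "{}"], rule exI[of _ "\<lambda>(p, q). (q, 0)"]) auto

lemma finite_state_ruleE: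
  fixes T :: "'d::finite config \<Rightarrow> 'd config"
  assumes "finite_state_rule n k T"
  obtains F f where "finite (F :: (int ^ 'd) set)"
    and "f \<in> (F \<rightarrow>\<^sub>E {0..<n}) \<times> {1..k} \<rightarrow> {1..k} \<times> UNIV"
    and "\<And>x q v. (x, q, v) \<in> configs n k \<Longrightarrow>
      T (x, q, v) = (let (q', u) = f (restrict (shift (- v) x) F, q) in (x, q', v + u))"
  using assms unfolding finite_state_rule_def by (elim exE conjE) (rule that, assumption, assumption, drule (1) bspec, simp)

lemma finite_state_ruleI:
  fixes T :: "'d::finite config \<Rightarrow> 'd config"
  assumes "finite (F :: (int ^ 'd) set)"
    and "f \<in> (F \<rightarrow>\<^sub>E {0..<n}) \<times> {1..k} \<rightarrow> {1..k} \<times> UNIV"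
    and "\<And>x q v. (x, q, v) \<in> configs n k \<Longrightarrow>
      T (x, q, v) = (let (q', u) = f (restrict (shift (- v) x) F, q) in (x, q', v + u))"
  shows "finite_state_rule n k T"
  unfolding finite_state_rule_def using assms
  by (intro exI[of _ F] exI[of _ f] conjI) (assumption | simp add: Ball_def)+

lemma finite_state_rule_comp:
  fixes S T :: "'d::finite config \<Rightarrow> 'd config"
  assumes "finite_state_rule n k S" "finite_state_rule n k T"
  shows "finite_state_rule n k (S \<circ> T)"
proof -
  obtain F1 f1 where F1: "finite F1"
    and f1: "f1 \<in> (F1 \<rightarrow>\<^sub>E {0..<n}) \<times> {1..k} \<rightarrow> {1..k} \<times> UNIV"
    and T: "\<And>x q v. (x, q, v) \<in> configs n k \<Longrightarrow>
      T (x, q, v) = (let (q', u) = f1 (restrict (shift (- v) x) F1, q) in (x, q', v + u))"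
    by (rule finite_state_ruleE[OF assms(2)]) (rule that; simp)
  obtain F2 f2 where F2: "finite F2"
    and f2: "f2 \<in> (F2 \<rightarrow>\<^sub>E {0..<n}) \<times> {1..k} \<rightarrow> {1..k} \<times> UNIV"
    and S: "\<And>x q v. (x, q, v) \<in> configs n k \<Longrightarrow>
      S (x, q, v) = (let (q', u) = f2 (restrict (shift (- v) x) F2, q) in (x, q', v + u))"
    by (rule finite_state_ruleE[OF assms(1)]) (rule that; simp)
  define U where "U = snd ` f1 ` ((F1 \<rightarrow>\<^sub>E {0..<n}) \<times> {1..k})"
  define F where "F = F1 \<union> (\<Union>u\<in>U. (\<lambda>w. w + u) ` F2)"
  define f where "f = (\<lambda>(p, q). let (q1, u1) = f1 (restrict p F1, q);
      (q2, u2) = f2 (\<lambda>w\<in>F2. p (w + u1), q1) in (q2, u1 + u2))"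
  have "finite U"
    unfolding U_def using F1 by (intro finite_imageI finite_cartesian_product finite_PiE) auto
  then have "finite F"
    unfolding F_def using F1 F2 by auto
  moreover have "f \<in> (F \<rightarrow>\<^sub>E {0..<n}) \<times> {1..k} \<rightarrow> {1..k} \<times> UNIV"
  proof (rule funcsetI, clarify)
    fix p q assume p: "p \<in> F \<rightarrow>\<^sub>E {0..<n}" and q: "q \<in> {1..k}"
    obtain q1 u1 where fu: "f1 (restrict p F1, q) = (q1, u1)" by fastforce
    have rp: "(restrict p F1, q) \<in> (F1 \<rightarrow>\<^sub>E {0..<n}) \<times> {1..k}"
      using p q by (auto simp: F_def PiE_iff)
    have q1: "q1 \<in> {1..k}" using funcset_mem[OF f1 rp] fu by simp
    have "u1 \<in> U" unfolding U_def using rp fu by (metis image_eqI snd_conv)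
    then have "w + u1 \<in> F" if "w \<in> F2" for w using that by (auto simp: F_def)
    then have "((\<lambda>w\<in>F2. p (w + u1)), q1) \<in> (F2 \<rightarrow>\<^sub>E {0..<n}) \<times> {1..k}"
      using p q1 by (auto simp: PiE_iff)
    from funcset_mem[OF f2 this] show "f (p, q) \<in> {1..k} \<times> UNIV"
      by (auto simp: f_def fu split: prod.splits)
  qed
  moreover have "(S \<circ> T) (x, q, v) =
      (let (q', u) = f (restrict (shift (- v) x) F, q) in (x, q', v + u))"
    if c: "(x, q, v) \<in> configs n k" for x q v
  proof -
    obtain q1 u1 where fu: "f1 (restrict (shift (- v) x) F1, q) = (q1, u1)" by fastforce
    have rp: "(restrict (shift (- v) x) F1, q) \<in> (F1 \<rightarrow>\<^sub>E {0..<n}) \<times> {1..k}"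
      using c by (auto simp: configs_def shift_def PiE_iff)
    have q1: "q1 \<in> {1..k}" using funcset_mem[OF f1 rp] fu by simp
    have "u1 \<in> U" unfolding U_def using rp fu by (metis image_eqI snd_conv)
    then have 1: "(\<lambda>w\<in>F2. restrict (shift (- v) x) F (w + u1)) =
        restrict (shift (- (v + u1)) x) F2"
      by (auto simp: F_def shift_def restrict_def fun_eq_iff algebra_simps)
    have 2: "restrict (restrict (shift (- v) x) F) F1 = restrict (shift (- v) x) F1"
      by (auto simp: F_def restrict_def fun_eq_iff)
    have "(x, q1, v + u1) \<in> configs n k" using c q1 by (simp add: configs_def)
    note ST = S[OF this] T[OF c]
    obtain q2 u2 where gu: "f2 (restrict (shift (- (v + u1)) x) F2, q1) = (q2, u2)" by fastforce
    have "f (restrict (shift (- v) x) F, q) = (q2, u1 + u2)"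
      unfolding f_def by (simp only: prod.case Let_def 2 fu 1 gu)
    then show ?thesis
      using ST by (simp only: comp_apply fu gu prod.case Let_def add.assoc)
  qed
  ultimately show ?thesis
    by (rule finite_state_ruleI)
qed

lemma subgroup_RFA:
  "subgroup (carrier (RFA TYPE('d::finite) n k)) (BijGroup (configs n k :: 'd config set))"
proof -
  let ?C = "configs n k :: 'd config set"
  interpret B: group "BijGroup ?C" by (rule group_BijGroup)
  have car: "carrier (RFA TYPE('d) n k) =
      {T \<in> Bij ?C. finite_state_rule n k T \<and> finite_state_rule n k (inv_into ?C T)}"
    by (simp add: RFA_def)
  have inv: "inv_into ?C T c = (inv\<^bsub>BijGroup ?C\<^esub> T) c" if "T \<in> Bij ?C" "c \<in> ?C" for T c
    using that by (simp add: inv_BijGroup)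
  have car': "T \<in> carrier (RFA TYPE('d) n k) \<longleftrightarrow> T \<in> Bij ?C \<and>
      finite_state_rule n k T \<and> finite_state_rule n k (inv\<^bsub>BijGroup ?C\<^esub> T)" for T
    unfolding car using finite_state_rule_cong[OF inv] by auto
  have Bc: "carrier (BijGroup ?C) = Bij ?C" by (simp add: BijGroup_def)
  have mult: "finite_state_rule n k (S \<otimes>\<^bsub>BijGroup ?C\<^esub> T)"
    if "S \<in> Bij ?C" "T \<in> Bij ?C" "finite_state_rule n k S" "finite_state_rule n k T" for S T
  proof -
    have "(S \<otimes>\<^bsub>BijGroup ?C\<^esub> T) c = (S \<circ> T) c" if "c \<in> ?C" for c
      using that \<open>S \<in> _\<close> \<open>T \<in> _\<close> by (simp add: BijGroup_def compose_eq)
    then have "finite_state_rule n k (S \<otimes>\<^bsub>BijGroup ?C\<^esub> T) \<longleftrightarrow> finite_state_rule n k (S \<circ> T)"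
      by (rule finite_state_rule_cong)
    with finite_state_rule_comp[OF that(3,4)] show ?thesis by blast
  qed
  have one: "finite_state_rule n k \<one>\<^bsub>BijGroup ?C\<^esub>"
    using finite_state_rule_cong[of n k "\<one>\<^bsub>BijGroup ?C\<^esub>" "\<lambda>c. c"] finite_state_rule_id
    by (simp add: BijGroup_def)
  show ?thesis
  proof (rule B.subgroupI)
    show "carrier (RFA TYPE('d) n k) \<subseteq> carrier (BijGroup ?C)"
      by (auto simp: car Bc)
    show "carrier (RFA TYPE('d) n k) \<noteq> {}"
      using one car'[of "\<one>\<^bsub>BijGroup ?C\<^esub>"] B.one_closed by (auto simp: Bc)
  next
    fix T assume "T \<in> carrier (RFA TYPE('d) n k)"
    then show "inv\<^bsub>BijGroup ?C\<^esub> T \<in> carrier (RFA TYPE('d) n k)"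
      using B.inv_closed[of T] B.inv_inv[of T] by (auto simp: car' Bc)
  next
    fix S T assume "S \<in> carrier (RFA TYPE('d) n k)" "T \<in> carrier (RFA TYPE('d) n k)"
    then show "S \<otimes>\<^bsub>BijGroup ?C\<^esub> T \<in> carrier (RFA TYPE('d) n k)"
      using B.m_closed[of S T] B.inv_closed[of S] B.inv_closed[of T]
      by (auto simp: car' Bc B.inv_mult_group intro!: mult)
  qed
qed

lemma group_RFA: "group (RFA TYPE('d::finite) n k)"
proof -
  interpret B: group "BijGroup (configs n k :: 'd config set)" by (rule group_BijGroup)
  have "RFA TYPE('d) n k = BijGroup (configs n k)\<lparr>carrier := carrier (RFA TYPE('d) n k)\<rparr>"
    by (simp add: RFA_def)
  with B.subgroup_imp_group[OF subgroup_RFA] show ?thesis by metis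
qed

end

theory Submission
  imports Defs "HOL-Combinatorics.Permutations"
begin

text \<open>
  A finitely generated group has only finitely many homomorphisms to \<open>{1, -1}\<close>, because such a
  homomorphism is determined by its values on the generators. So it suffices to find infinitely
  many of them on the group of reversible finite-state automata.

  Fix a coordinate \<open>i\<close> and consider for each \<open>p \<ge> 2\<close> the tape \<open>comb i p\<close> that carries the symbol
  \<open>1\<close> on the hyperplanes \<open>p dvd v $ i\<close> and \<open>0\<close> elsewhere. An automaton never changes the tape, and
  what it does at a position of this tape depends only on the state and on \<open>v $ i\<close> modulo \<open>p\<close>.
  Hence it induces a permutation of the finite set of pairs (state, residue modulo \<open>p\<close>), and the
  sign of that permutation is a character (\<open>sign_residue_action_mult\<close>).

  These characters are pairwise distinct. The automaton \<open>tooth_swap i p\<close>, in state \<open>1\<close>, exchanges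
  the positions \<open>v\<close> and \<open>v + axis i 1\<close> whenever the tape carries a \<open>1\<close> at \<open>v\<close> that is followed
  in direction \<open>i\<close> by \<open>p - 1\<close> symbols other than \<open>1\<close>. On \<open>comb i p\<close> this happens once per period,
  so the induced permutation is a transposition and has sign \<open>-1\<close> (\<open>sign_tooth_swap_same\<close>). On a
  comb of smaller period the next \<open>1\<close> comes too early, the automaton does nothing, and the sign is
  \<open>1\<close> (\<open>sign_tooth_swap_shorter\<close>).
\<close>

section \<open>Sign characters of finitely generated groups\<close>

lemma sign_character_one_inv:
  fixes \<epsilon> :: "'a \<Rightarrow> int"
  assumes "group G"
    and mult: "\<And>g h. g \<in> carrier G \<Longrightarrow> h \<in> carrier G \<Longrightarrow> \<epsilon> (g \<otimes>\<^bsub>G\<^esub> h) = \<epsilon> g * \<epsilon> h"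
    and sgn: "\<And>g. g \<in> carrier G \<Longrightarrow> \<epsilon> g \<in> {1, -1}"
  shows "\<epsilon> \<one>\<^bsub>G\<^esub> = 1" and "g \<in> carrier G \<Longrightarrow> \<epsilon> (inv\<^bsub>G\<^esub> g) = \<epsilon> g"
proof -
  interpret group G by fact
  have "\<epsilon> \<one>\<^bsub>G\<^esub> * \<epsilon> \<one>\<^bsub>G\<^esub> = \<epsilon> \<one>\<^bsub>G\<^esub>"
    using mult[OF one_closed one_closed] by simp
  then show one: "\<epsilon> \<one>\<^bsub>G\<^esub> = 1"
    using sgn[OF one_closed] by auto
  show "\<epsilon> (inv\<^bsub>G\<^esub> g) = \<epsilon> g" if g: "g \<in> carrier G"
  proof -
    have "\<epsilon> g * \<epsilon> (inv\<^bsub>G\<^esub> g) = 1"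
      using mult[OF g inv_closed[OF g]] one g by simp
    then show ?thesis
      using sgn[OF g] sgn[OF inv_closed[OF g]] by auto
  qed
qed

text \<open>
  Pigeonhole: on a finite generating set there are only finitely many patterns of signs, and two
  characters with the same pattern agree on everything that the set generates.
\<close>

lemma finitely_generated_sign_characters_coincide:
  fixes \<epsilon> :: "'i \<Rightarrow> 'a \<Rightarrow> int"
  assumes "group G" and "finitely_generated G" and "infinite I"
    and mult: "\<And>i g h. i \<in> I \<Longrightarrow> g \<in> carrier G \<Longrightarrow> h \<in> carrier G \<Longrightarrow>
      \<epsilon> i (g \<otimes>\<^bsub>G\<^esub> h) = \<epsilon> i g * \<epsilon> i h"
    and sgn: "\<And>i g. i \<in> I \<Longrightarrow> g \<in> carrier G \<Longrightarrow> \<epsilon> i g \<in> {1, -1}"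
  obtains i j where "i \<in> I" "j \<in> I" "i \<noteq> j" "\<And>g. g \<in> carrier G \<Longrightarrow> \<epsilon> i g = \<epsilon> j g"
proof -
  interpret group G by fact
  obtain S where "finite S" and S: "S \<subseteq> carrier G" and gen: "generate G S = carrier G"
    using \<open>finitely_generated G\<close> unfolding finitely_generated_def by blast
  have "(\<lambda>i. restrict (\<epsilon> i) S) ` I \<subseteq> S \<rightarrow>\<^sub>E {1, -1}"
    using sgn S by (auto simp: image_subset_iff)
  moreover have "finite (S \<rightarrow>\<^sub>E {1, -1 :: int})"
    using \<open>finite S\<close> by (intro finite_PiE) auto
  ultimately have "\<not> inj_on (\<lambda>i. restrict (\<epsilon> i) S) I"
    using \<open>infinite I\<close> finite_subset finite_imageD by blast
  then obtain i j where ij: "i \<in> I" "j \<in> I" "i \<noteq> j"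
    and eq: "restrict (\<epsilon> i) S = restrict (\<epsilon> j) S"
    unfolding inj_on_def by blast
  have sign_one: "\<epsilon> l \<one>\<^bsub>G\<^esub> = 1" if "l \<in> I" for l
    by (rule sign_character_one_inv(1)[OF \<open>group G\<close> mult[OF that] sgn[OF that]])
  have sign_inv: "\<epsilon> l (inv\<^bsub>G\<^esub> g) = \<epsilon> l g" if "l \<in> I" "g \<in> carrier G" for l g
    by (rule sign_character_one_inv(2)[OF \<open>group G\<close> mult[OF that(1)] sgn[OF that(1)] that(2)])
  have "\<epsilon> i g = \<epsilon> j g" if "g \<in> generate G S" for g
    using that
  proof (induction rule: generate.induct)
    case one
    show ?case
      using sign_one[OF ij(1)] sign_one[OF ij(2)] by simp
  next
    case (incl h)
    then show ?case using fun_cong[OF eq, of h] by simp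
  next
    case (inv h)
    then have "h \<in> carrier G" using S by blast
    then show ?case
      using inv fun_cong[OF eq, of h] sign_inv[OF ij(1)] sign_inv[OF ij(2)] by simp
  next
    case (eng g h)
    then have "g \<in> carrier G" "h \<in> carrier G" using gen by auto
    then show ?case using eng.IH mult[OF ij(1)] mult[OF ij(2)] by simp
  qed
  then show thesis using that[OF ij] gen by simp
qed


section \<open>The characters of comb tapes\<close>

definition comb :: "'d::finite \<Rightarrow> nat \<Rightarrow> 'd tape"
  where "comb i p = (\<lambda>v. if int p dvd v $ i then 1 else 0)"

definition residue :: "'d::finite \<Rightarrow> nat \<Rightarrow> 'd config \<Rightarrow> nat \<times> int"
  where "residue i p = (\<lambda>(x, q, v). (q, v $ i mod int p))"

text \<open>
  The representative \<open>axis i c\<close> of the residue \<open>c\<close> is arbitrary: by \<open>finite_state_rule_comb\<close> any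
  other one gives the same value. Outside the finite set of interest the action is the identity, so
  that \<^const>\<open>permutes\<close> and \<^const>\<open>sign\<close> apply.
\<close>

definition residue_action ::
    "'d::finite \<Rightarrow> nat \<Rightarrow> nat \<Rightarrow> ('d config \<Rightarrow> 'd config) \<Rightarrow> nat \<times> int \<Rightarrow> nat \<times> int"
  where "residue_action i k p T = (\<lambda>(q, c). if (q, c) \<in> {1..k} \<times> {0..<int p}
    then residue i p (T (comb i p, q, axis i c)) else (q, c))"

lemma comb_in_configs:
  assumes "n \<ge> 2" and "q \<in> {1..k}"
  shows "(comb i p, q, v) \<in> configs n k"
  using assms by (auto simp: configs_def comb_def)

lemma shift_comb_cong:
  assumes "v $ i mod int p = w $ i mod int p"
  shows "shift (- v) (comb i p) = shift (- w) (comb i p)"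
proof -
  have "(u $ i + v $ i) mod int p = (u $ i + w $ i) mod int p" for u
    using assms by (metis mod_add_right_eq)
  then have "int p dvd u $ i + v $ i \<longleftrightarrow> int p dvd u $ i + w $ i" for u
    unfolding dvd_eq_mod_eq_0 by metis
  then show ?thesis
    by (simp add: shift_def comb_def fun_eq_iff)
qed

text \<open>
  An automaton sees the tape only relative to its head, and the comb looks the same from positions
  with the same residue. This makes \<^const>\<open>residue\<close> a semiconjugacy from the automaton on the comb
  to its \<^const>\<open>residue_action\<close>.
\<close>

lemma finite_state_rule_comb:
  fixes T :: "'d::finite config \<Rightarrow> 'd config"
  assumes "finite_state_rule n k T" and "n \<ge> 2" and "p > 0" and q: "q \<in> {1..k}"
  obtains q' v' where "T (comb i p, q, v) = (comb i p, q', v')" "q' \<in> {1..k}"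
    "residue_action i k p T (residue i p (comb i p, q, v)) = residue i p (comb i p, q', v')"
proof -
  obtain F f where f: "f \<in> (F \<rightarrow>\<^sub>E {0..<n}) \<times> {1..k} \<rightarrow> {1..k} \<times> UNIV"
    and T: "\<And>x q v. (x, q, v) \<in> configs n k \<Longrightarrow>
      T (x, q, v) = (let (q', u) = f (restrict (shift (- v) x) F, q) in (x, q', v + u))"
    by (rule finite_state_ruleE[OF assms(1)]) (rule that; simp)
  let ?w = "axis i (v $ i mod int p) :: int ^ 'd"
  have "?w $ i = v $ i mod int p" by simp
  then have sh: "shift (- ?w) (comb i p) = shift (- v) (comb i p)"
    by (intro shift_comb_cong) simp
  obtain q' u where fu: "f (restrict (shift (- v) (comb i p)) F, q) = (q', u)" by fastforce
  have "(restrict (shift (- v) (comb i p)) F, q) \<in> (F \<rightarrow>\<^sub>E {0..<n}) \<times> {1..k}"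
    using q \<open>n \<ge> 2\<close> by (auto simp: shift_def comb_def)
  from funcset_mem[OF f this] have q': "q' \<in> {1..k}" by (simp add: fu)
  have Tv: "T (comb i p, q, v) = (comb i p, q', v + u)"
    using T[OF comb_in_configs[OF \<open>n \<ge> 2\<close> q]] fu by simp
  have "T (comb i p, q, ?w) = (comb i p, q', ?w + u)"
    using T[OF comb_in_configs[OF \<open>n \<ge> 2\<close> q]] fu sh by simp
  then have "residue_action i k p T (residue i p (comb i p, q, v)) =
      residue i p (comb i p, q', v + u)"
    using q \<open>p > 0\<close> by (simp add: residue_action_def residue_def mod_add_left_eq)
  with Tv q' show thesis by (rule that)
qed

lemma residue_surj:
  assumes "z \<in> {1..k} \<times> {0..<int p}"
  obtains q v where "q \<in> {1..k}" "z = residue i p (comb i p, q, v)"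
  using assms by (auto simp: residue_def intro!: that[of "fst z" "axis i (snd z)"])

text \<open>
  The product in \<^const>\<open>RFA\<close> is composition restricted to the configurations, so the composite is
  represented by a function \<open>R\<close> that is only known there.
\<close>

lemma residue_action_comp:
  fixes S T :: "'d::finite config \<Rightarrow> 'd config"
  assumes S: "finite_state_rule n k S" and T: "finite_state_rule n k T" and "n \<ge> 2" and "p > 0"
    and R: "\<And>c. c \<in> configs n k \<Longrightarrow> R c = S (T c)"
  shows "residue_action i k p R = residue_action i k p S \<circ> residue_action i k p T"
proof
  fix z :: "nat \<times> int"
  have fR: "finite_state_rule n k R"
    using finite_state_rule_comp[OF S T] finite_state_rule_cong[of n k R "S \<circ> T"] R by simp
  show "residue_action i k p R z = (residue_action i k p S \<circ> residue_action i k p T) z"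
  proof (cases "z \<in> {1..k} \<times> {0..<int p}")
    case True
    then obtain q v where q: "q \<in> {1..k}" and z: "z = residue i p (comb i p, q, v)"
      by (rule residue_surj)
    obtain q' v' where t: "T (comb i p, q, v) = (comb i p, q', v')" "q' \<in> {1..k}"
      "residue_action i k p T (residue i p (comb i p, q, v)) = residue i p (comb i p, q', v')"
      by (rule finite_state_rule_comb[OF T \<open>n \<ge> 2\<close> \<open>p > 0\<close> q])
    obtain q'' v'' where s: "S (comb i p, q', v') = (comb i p, q'', v'')"
      "residue_action i k p S (residue i p (comb i p, q', v')) = residue i p (comb i p, q'', v'')"
      by (rule finite_state_rule_comb[OF S \<open>n \<ge> 2\<close> \<open>p > 0\<close> t(2)])
    obtain q3 v3 where r: "R (comb i p, q, v) = (comb i p, q3, v3)"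
      "residue_action i k p R (residue i p (comb i p, q, v)) = residue i p (comb i p, q3, v3)"
      by (rule finite_state_rule_comb[OF fR \<open>n \<ge> 2\<close> \<open>p > 0\<close> q])
    have "R (comb i p, q, v) = (comb i p, q'', v'')"
      using R[OF comb_in_configs[OF \<open>n \<ge> 2\<close> q]] t(1) s(1) by simp
    then show ?thesis using r s(2) t(3) z by simp
  next
    case False
    then show ?thesis by (auto simp: residue_action_def split: prod.splits)
  qed
qed

lemma residue_action_id:
  assumes "n \<ge> 2" and "\<And>c. c \<in> configs n k \<Longrightarrow> R c = c"
  shows "residue_action i k p R = id"
proof
  fix z :: "nat \<times> int"
  show "residue_action i k p R z = id z"
    using assms(2)[OF comb_in_configs[OF assms(1)], of "fst z" i p "axis i (snd z)"]
    by (auto simp: residue_action_def residue_def split: prod.splits)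
qed

lemma residue_action_permutes:
  fixes T :: "'d::finite config \<Rightarrow> 'd config"
  assumes T: "T \<in> carrier (RFA TYPE('d) n k)" and "n \<ge> 2" and "p > 0"
  shows "residue_action i k p T permutes {1..k} \<times> {0..<int p}"
proof -
  let ?T' = "inv_into (configs n k) T"
  have bij: "bij_betw T (configs n k) (configs n k)"
    and fin: "finite_state_rule n k T" "finite_state_rule n k ?T'"
    using T by (auto simp: RFA_def Bij_def)
  have "residue_action i k p ?T' \<circ> residue_action i k p T = id"
    using residue_action_comp[OF fin(2,1) \<open>n \<ge> 2\<close> \<open>p > 0\<close>, of "\<lambda>c. ?T' (T c)" i]
      residue_action_id[OF \<open>n \<ge> 2\<close>, of k "\<lambda>c. ?T' (T c)" i p] bij
    by (simp add: bij_betw_inv_into_left)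
  moreover have "residue_action i k p T \<circ> residue_action i k p ?T' = id"
    using residue_action_comp[OF fin \<open>n \<ge> 2\<close> \<open>p > 0\<close>, of "\<lambda>c. T (?T' c)" i]
      residue_action_id[OF \<open>n \<ge> 2\<close>, of k "\<lambda>c. T (?T' c)" i p] bij
    by (simp add: bij_betw_inv_into_right)
  ultimately have "bij (residue_action i k p T)" by (rule o_bij)
  moreover have "residue_action i k p T z = z" if "z \<notin> {1..k} \<times> {0..<int p}" for z
    using that by (cases z) (auto simp: residue_action_def)
  ultimately show ?thesis
    unfolding permutes_def bij_iff by blast
qed

lemma sign_residue_action_mult:
  fixes S T :: "'d::finite config \<Rightarrow> 'd config"
  assumes S: "S \<in> carrier (RFA TYPE('d) n k)" and T: "T \<in> carrier (RFA TYPE('d) n k)"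
    and "n \<ge> 2" and "p > 0"
  shows "sign (residue_action i k p (S \<otimes>\<^bsub>RFA TYPE('d) n k\<^esub> T)) =
    sign (residue_action i k p S) * sign (residue_action i k p T)"
proof -
  have "(S \<otimes>\<^bsub>RFA TYPE('d) n k\<^esub> T) c = S (T c)" if "c \<in> configs n k" for c
    using that S T by (simp add: RFA_def BijGroup_def compose_eq)
  then have "residue_action i k p (S \<otimes>\<^bsub>RFA TYPE('d) n k\<^esub> T) =
      residue_action i k p S \<circ> residue_action i k p T"
    using S T \<open>n \<ge> 2\<close> \<open>p > 0\<close> by (intro residue_action_comp) (auto simp: RFA_def)
  moreover have "permutation (residue_action i k p S)" "permutation (residue_action i k p T)"
    using residue_action_permutes[of _ n k p i] S T \<open>n \<ge> 2\<close> \<open>p > 0\<close>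
    by (auto intro!: permutes_imp_permutation[of "{1..k} \<times> {0..<int p}"])
  ultimately show ?thesis by (simp add: sign_compose)
qed


section \<open>Automata detecting a single comb\<close>

definition tooth :: "'d::finite \<Rightarrow> nat \<Rightarrow> 'd tape \<Rightarrow> int ^ 'd \<Rightarrow> bool"
  where "tooth i p x v \<longleftrightarrow> x v = 1 \<and> (\<forall>j\<in>{1..<int p}. x (v + axis i j) \<noteq> 1)"

definition tooth_step :: "'d::finite \<Rightarrow> nat \<Rightarrow> 'd tape \<Rightarrow> int ^ 'd \<Rightarrow> int ^ 'd"
  where "tooth_step i p x v =
    (if tooth i p x v then axis i 1 else if tooth i p x (v - axis i 1) then - axis i 1 else 0)"

definition tooth_swap :: "'d::finite \<Rightarrow> nat \<Rightarrow> 'd config \<Rightarrow> 'd config"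
  where "tooth_swap i p = (\<lambda>(x, q, v). (x, q, if q = 1 then v + tooth_step i p x v else v))"

text \<open>
  The second of two neighbouring teeth would violate the gap demanded after the first, which has
  length \<open>p - 1 \<ge> 1\<close>. Hence the exchanged pairs of positions are disjoint, and the exchange is an
  involution.
\<close>

lemma tooth_not_adjacent:
  assumes "p \<ge> 2" and "tooth i p x v"
  shows "\<not> tooth i p x (v + axis i 1)"
  using assms by (auto simp: tooth_def)

lemma tooth_swap_involution:
  assumes "p \<ge> 2"
  shows "tooth_swap i p (tooth_swap i p c) = c"
proof -
  obtain x q v where c: "c = (x, q, v)" by (cases c)
  have "tooth_step i p x (v + tooth_step i p x v) = - tooth_step i p x v"
    using tooth_not_adjacent[OF assms, of i x v] tooth_not_adjacent[OF assms, of i x "v - axis i 1"]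
    by (auto simp: tooth_step_def)
  then show ?thesis by (simp add: tooth_swap_def c)
qed

text \<open>
  Deciding whether \<open>v\<close> or \<open>v - axis i 1\<close> is a tooth takes the offsets from \<open>-1\<close> to \<open>p - 1\<close>.
\<close>

lemma tooth_step_local:
  assumes F: "F = axis i ` {-1..<int p}" and "p \<ge> 2"
  shows "tooth_step i p (restrict (shift (- v) x) F) 0 = tooth_step i p x v"
proof -
  let ?r = "restrict (shift (- v) x) F"
  have r: "?r (axis i j) = x (v + axis i j)" if "j \<in> {-1..<int p}" for j
    using that by (simp add: F shift_def add.commute)
  have ax: "axis i a + axis i b = axis i (a + b)" and neg: "axis i (-1) = - axis i (1 :: int)"
    and zero: "axis i 0 = 0" for a b :: int
    by (auto simp: axis_def vec_eq_iff)
  have "tooth i p ?r (axis i c) \<longleftrightarrow> tooth i p x (v + axis i c)" if c: "c \<in> {-1, 0}" for c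
  proof -
    have "(\<forall>j\<in>{1..<int p}. ?r (axis i c + axis i j) \<noteq> 1) \<longleftrightarrow>
        (\<forall>j\<in>{1..<int p}. x (v + axis i c + axis i j) \<noteq> 1)"
    proof (rule ball_cong[OF refl])
      fix j assume "j \<in> {1..<int p}"
      then have "c + j \<in> {-1..<int p}" using c by auto
      then show "?r (axis i c + axis i j) \<noteq> 1 \<longleftrightarrow> x (v + axis i c + axis i j) \<noteq> 1"
        using r[of "c + j"] by (simp only: ax add.assoc)
    qed
    moreover have "?r (axis i c) = x (v + axis i c)" using c \<open>p \<ge> 2\<close> by (intro r) auto
    ultimately show ?thesis by (simp only: tooth_def)
  qed
  from this[of 0] this[of "-1"] show ?thesis
    by (simp add: tooth_step_def neg zero)
qed

lemma tooth_swap_finite_state_rule: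
  assumes "p \<ge> 2"
  shows "finite_state_rule n k (tooth_swap (i :: 'd::finite) p)"
proof (rule finite_state_ruleI)
  let ?F = "axis i ` {-1..<int p} :: (int ^ 'd) set"
  let ?f = "\<lambda>(r, q). (q, if q = (1 :: nat) then tooth_step i p r 0 else 0)"
  show "finite ?F" by simp
  show "?f \<in> (?F \<rightarrow>\<^sub>E {0..<n}) \<times> {1..k} \<rightarrow> {1..k} \<times> UNIV" by auto
  show "tooth_swap i p (x, q, v) =
      (let (q', u) = ?f (restrict (shift (- v) x) ?F, q) in (x, q', v + u))" for x q v
    using tooth_step_local[OF refl assms, of i v x] by (simp add: tooth_swap_def)
qed

lemma tooth_swap_in_RFA:
  assumes "p \<ge> 2"
  shows "restrict (tooth_swap (i :: 'd::finite) p) (configs n k) \<in> carrier (RFA TYPE('d) n k)"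
proof -
  let ?C = "configs n k :: 'd config set" and ?T = "tooth_swap i p"
  have inC: "?T c \<in> ?C" if "c \<in> ?C" for c
    using that by (auto simp: tooth_swap_def configs_def)
  have bij: "bij_betw (restrict ?T ?C) ?C ?C"
    using inC tooth_swap_involution[OF assms, of i]
    by (intro bij_betw_byWitness[where f' = "?T"]) auto
  have "inv_into ?C (restrict ?T ?C) c = ?T c" if "c \<in> ?C" for c
    using inv_into_f_eq[OF bij_betw_imp_inj_on[OF bij], of "?T c" c] inC[OF that]
      tooth_swap_involution[OF assms, of i c] by simp
  then have "finite_state_rule n k (inv_into ?C (restrict ?T ?C))"
    using finite_state_rule_cong[of n k "inv_into ?C (restrict ?T ?C)" ?T]
      tooth_swap_finite_state_rule[OF assms] by blast
  moreover have "finite_state_rule n k (restrict ?T ?C)"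
    using finite_state_rule_cong[of n k "restrict ?T ?C" ?T]
      tooth_swap_finite_state_rule[OF assms] by simp
  ultimately show ?thesis
    using bij by (simp add: RFA_def Bij_def)
qed

text \<open>
  The next \<open>1\<close> of the comb, at distance \<open>p' < p\<close>, falls into the gap that \<open>tooth i p\<close> requires.
\<close>

lemma tooth_comb_shorter:
  assumes "0 < p'" and "p' < p"
  shows "\<not> tooth i p (comb i p') v"
proof
  assume "tooth i p (comb i p') v"
  then have "comb i p' v = 1" and "comb i p' (v + axis i (int p')) \<noteq> 1"
    using assms by (auto simp: tooth_def)
  then show False by (simp add: comb_def split: if_splits)
qed

lemma tooth_comb_same:
  assumes "p > 0"
  shows "tooth i p (comb i p) v \<longleftrightarrow> int p dvd v $ i"
proof -
  have "\<not> int p dvd v $ i + j" if "int p dvd v $ i" "j \<in> {1..<int p}" for j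
    using that zdvd_not_zless[of j "int p"] by (simp add: dvd_add_right_iff)
  then show ?thesis by (auto simp: tooth_def comb_def)
qed

lemma sign_tooth_swap_shorter:
  assumes "n \<ge> 2" and "0 < p'" and "p' < p"
  shows "sign (residue_action i k p' (restrict (tooth_swap i p) (configs n k))) = 1"
proof -
  have "residue_action i k p' (restrict (tooth_swap i p) (configs n k)) z = z" for z
    using comb_in_configs[OF assms(1), of "fst z" k i p' "axis i (snd z)"]
    by (auto simp: residue_action_def residue_def tooth_swap_def tooth_step_def
        tooth_comb_shorter[OF assms(2,3)] split: prod.splits)
  then have "residue_action i k p' (restrict (tooth_swap i p) (configs n k)) = id"
    by (simp add: fun_eq_iff)
  then show ?thesis by simp
qed

text \<open>
  The only tooth among the residues modulo \<open>p\<close> is \<open>0\<close>. Exchanging in state \<open>1\<close> alone leaves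
  exactly one transposition, whatever the number of states; if every state took part, there would
  be \<open>k\<close> of them and an even \<open>k\<close> would give sign \<open>1\<close>.
\<close>

lemma sign_tooth_swap_same:
  assumes "n \<ge> 2" and "k \<ge> 1" and "p \<ge> 2"
  shows "sign (residue_action i k p (restrict (tooth_swap i p) (configs n k))) = -1"
proof -
  have "residue_action i k p (restrict (tooth_swap i p) (configs n k)) (q, c) =
      transpose (1, 0) (1, 1) (q, c)" for q c
  proof (cases "(q, c) \<in> {1..k} \<times> {0..<int p}")
    case True
    have d0: "int p dvd c \<longleftrightarrow> c = 0"
      using True zdvd_not_zless[of c "int p"] by force
    have d1: "int p dvd c - 1 \<longleftrightarrow> c = 1"
      using True \<open>p \<ge> 2\<close> zdvd_not_zless[of "c - 1" "int p"] by (cases "c = 0") force+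
    show ?thesis
      using True \<open>p \<ge> 2\<close> comb_in_configs[OF assms(1), of q k i p "axis i c"]
      by (auto simp: residue_action_def residue_def tooth_swap_def tooth_step_def
          tooth_comb_same d0 d1 transpose_def)
  next
    case False
    then show ?thesis
      using \<open>k \<ge> 1\<close> \<open>p \<ge> 2\<close> by (auto simp: residue_action_def transpose_def)
  qed
  then have "residue_action i k p (restrict (tooth_swap i p) (configs n k)) =
      transpose (1, 0) (1, 1)"
    by (simp add: fun_eq_iff)
  then show ?thesis by (simp add: sign_swap_id)
qed


theorem theorem3p5:
  fixes n k :: nat
  assumes "k \<ge> 1" and "n \<ge> 2"
  shows "\<not> finitely_generated (RFA TYPE('d::finite) n k)"
proof
  assume fg: "finitely_generated (RFA TYPE('d) n k)"
  fix i :: 'd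
  let ?\<epsilon> = "\<lambda>p T. sign (residue_action i k p T)"
  have inf: "infinite {2 :: nat..}" by (rule infinite_Ici)
  obtain p' p where "p' \<in> {2..}" "p \<in> {2..}" "p' \<noteq> p"
    and eq: "\<And>T. T \<in> carrier (RFA TYPE('d) n k) \<Longrightarrow> ?\<epsilon> p' T = ?\<epsilon> p T"
  proof (rule finitely_generated_sign_characters_coincide[OF group_RFA fg inf, of ?\<epsilon>])
    show "?\<epsilon> p (S \<otimes>\<^bsub>RFA TYPE('d) n k\<^esub> T) = ?\<epsilon> p S * ?\<epsilon> p T"
      if "p \<in> {2..}" "S \<in> carrier (RFA TYPE('d) n k)" "T \<in> carrier (RFA TYPE('d) n k)" for p S T
      using that \<open>n \<ge> 2\<close> by (intro sign_residue_action_mult) auto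
    show "?\<epsilon> p T \<in> {1, -1}" for p T by (simp add: sign_def)
  qed (rule that)
  define a b where "a = min p' p" and "b = max p' p"
  have ab: "2 \<le> a" "a < b"
    using \<open>p' \<in> _\<close> \<open>p \<in> _\<close> \<open>p' \<noteq> p\<close> by (auto simp: a_def b_def)
  have "?\<epsilon> a T = ?\<epsilon> b T" if "T \<in> carrier (RFA TYPE('d) n k)" for T
    using eq[OF that] by (simp add: a_def b_def min_def max_def)
  \<comment> \<open>the automaton that detects the longer period \<open>b\<close> separates the two characters\<close>
  from this[OF tooth_swap_in_RFA] show False
    using sign_tooth_swap_shorter[OF \<open>n \<ge> 2\<close>, of a b i k]
      sign_tooth_swap_same[OF \<open>n \<ge> 2\<close> \<open>k \<ge> 1\<close>, of b i] ab by simp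
qed

end
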